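(* If $G$ is a co-interval graph, then $G$ is $12$-representable.
   Context: All graphs are simple and finite. For a word $w$ over the positive integers, $A(w)$ is the set of letters occurring in $w$; for $B\subseteq A(w)$, $w_B$ is the word obtained from $w$ by deleting all letters not in $B$. A word $w=w_1\cdots w_m$ has a $12$-match if $w_i<w_{i+1}$ for some $i$. A labeled graph $G=([n],E)$, with $[n]=\{1,\ldots,n\}$, is $12$-representable if there is a word $w\in[n]^*$ with $A(w)=[n]$ such that for all distinct $x,y\in[n]$: $xy\in E$ if and only if $w_{\{x,y\}}$ has no $12$-match. An unlabeled graph is $12$-representable if some labeling of its vertices by $[n]$ (where $n$ is the number of vertices) gives a $12$-representable labeled graph. An interval graph is the intersection graph of a family of intervals on the real line: it has one vertex for each interval in the family, and an edge between every pair of vertices corresponding to intervals that intersect. A graph is co-interval if its complement is an interval graph. *)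

theory Defs
  imports "HOL-Analysis.Analysis"
begin

text \<open>A graph is given by its vertex set \<open>V\<close> and its set \<open>E\<close> of edges, an edge being a
  two-element set of vertices.\<close>

definition simple_graph :: "'a set \<Rightarrow> 'a set set \<Rightarrow> bool" where
  "simple_graph V E \<longleftrightarrow> finite V \<and> (\<forall>e\<in>E. e \<subseteq> V \<and> card e = 2)"

definition complement_edges :: "'a set \<Rightarrow> 'a set set \<Rightarrow> 'a set set" where
  "complement_edges V E = {e. e \<subseteq> V \<and> card e = 2 \<and> e \<notin> E}"

definition intersection_edges :: "'a set \<Rightarrow> ('a \<Rightarrow> 'b set) \<Rightarrow> 'a set set" where
  "intersection_edges V I = {{x, y} | x y. x \<in> V \<and> y \<in> V \<and> x \<noteq> y \<and> I x \<inter> I y \<noteq> {}}"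

text \<open>The intervals form a family indexed by the vertices, so different vertices may carry the
  same interval. Intervals are nonempty, but may be open, closed, half-open, degenerate or
  unbounded.\<close>

definition interval_graph :: "'a set \<Rightarrow> 'a set set \<Rightarrow> bool" where
  "interval_graph V E \<longleftrightarrow> simple_graph V E \<and>
     (\<exists>I :: 'a \<Rightarrow> real set. (\<forall>v\<in>V. is_interval (I v) \<and> I v \<noteq> {}) \<and> E = intersection_edges V I)"

definition co_interval_graph :: "'a set \<Rightarrow> 'a set set \<Rightarrow> bool" where
  "co_interval_graph V E \<longleftrightarrow> simple_graph V E \<and> interval_graph V (complement_edges V E)"

text \<open>The alphabet of a word \<open>w\<close> is \<open>set w\<close>.\<close>

definition restrict_word :: "nat list \<Rightarrow> nat set \<Rightarrow> nat list" where
  "restrict_word w B = filter (\<lambda>a. a \<in> B) w"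

definition has_12_match :: "nat list \<Rightarrow> bool" where
  "has_12_match w \<longleftrightarrow> (\<exists>i. Suc i < length w \<and> w ! i < w ! Suc i)"

text \<open>In the next definition \<open>E\<close> is the edge set of a labeled graph on the vertices \<open>{1..n}\<close>.\<close>

definition labeled_12_representable :: "nat \<Rightarrow> nat set set \<Rightarrow> bool" where
  "labeled_12_representable n E \<longleftrightarrow>
     (\<exists>w. set w = {1..n} \<and>
       (\<forall>x\<in>{1..n}. \<forall>y\<in>{1..n}. x \<noteq> y \<longrightarrow>
          ({x, y} \<in> E \<longleftrightarrow> \<not> has_12_match (restrict_word w {x, y}))))"

text \<open>A labeling \<open>f\<close> turns the edge set \<open>E\<close> into \<open>(`) f ` E\<close>, each edge being mapped to its
  image under \<open>f\<close>.\<close>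

definition representable_12 :: "'a set \<Rightarrow> 'a set set \<Rightarrow> bool" where
  "representable_12 V E \<longleftrightarrow>
     (\<exists>f. bij_betw f V {1..card V} \<and> labeled_12_representable (card V) ((`) f ` E))"

end

theory Submission imports Defs begin

text \<open>Let the complement of the graph be the intersection graph of the intervals \<open>I v\<close>. For
  labels \<open>x < y\<close>, the word must place every \<open>y\<close> before every \<open>x\<close> exactly if the two intervals
  are disjoint. So number the vertices from right to left: of two disjoint intervals, the left one
  gets the larger label (\<open>antitone_labelling\<close>, applied to one chosen point of each interval).
  Choose further a finite set of points that meets every nonempty intersection \<open>I u \<inter> I v\<close>, run
  through these points from left to right, and at each point \<open>p\<close> write down, in increasing order,
  the labels of the intervals that contain \<open>p\<close>.

  If two intervals intersect, they share a chosen point, and there the smaller label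
  stands before the larger one: a 12-match. If they are disjoint, no block contains
  both labels, and all points of the left interval, which has the larger label, come first: no
  12-match. Working with common points instead of endpoints treats open, closed and
  unbounded intervals alike.\<close>

text \<open>By transitivity, a word without an adjacent ascent has no ascent at all. This frees the
  later arguments from tracking which letters become adjacent after a deletion.\<close>

lemma has_12_match_iff_not_sorted_wrt_ge:
  "has_12_match w \<longleftrightarrow> \<not> sorted_wrt (\<ge>) w"
proof -
  have "transp ((\<ge>) :: nat \<Rightarrow> nat \<Rightarrow> bool)"
    by (auto intro: transpI)
  then show ?thesis
    unfolding has_12_match_def by (subst sorted_wrt_iff_nth_Suc_transp) (auto simp: not_le)
qed

lemma has_12_match_if_smaller_first:
  assumes "x < y" "x \<in> set us" "y \<in> set vs"
  shows "has_12_match (restrict_word (us @ vs) {x, y})"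
  using assms by (fastforce simp: has_12_match_iff_not_sorted_wrt_ge restrict_word_def
      sorted_wrt_append)

lemma has_12_match_if_increasing_block:
  assumes "x < y" "sorted block" "x \<in> set block" "y \<in> set block"
  shows "has_12_match (restrict_word (us @ block @ vs) {x, y})"
proof -
  obtain as bs where block: "block = as @ y # bs"
    using assms(4) by (meson split_list)
  with assms(1-3) have "x \<in> set as"
    by (auto simp: sorted_append)
  then have "has_12_match (restrict_word ((us @ as) @ (y # bs @ vs)) {x, y})"
    using assms(1) by (intro has_12_match_if_smaller_first) auto
  then show ?thesis
    by (simp add: block)
qed

text \<open>Blocks are indexed by points in increasing order. Within a block the restricted word is
  constant, and from one block to a later one it cannot ascend from \<open>x\<close> to \<open>y\<close>, as that would
  put an occurrence of \<open>x\<close> at a smaller point than an occurrence of \<open>y\<close>.\<close>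

lemma no_12_match_if_larger_blocks_first:
  fixes ps :: "'p::linorder list"
  assumes "x < y"
    and "sorted_wrt (<) ps"
    and disjoint: "\<And>p. p \<in> set ps \<Longrightarrow> \<not> (x \<in> set (F p) \<and> y \<in> set (F p))"
    and before: "\<And>p p'. p \<in> set ps \<Longrightarrow> p' \<in> set ps \<Longrightarrow> y \<in> set (F p) \<Longrightarrow> x \<in> set (F p') \<Longrightarrow> p < p'"
  shows "\<not> has_12_match (restrict_word (concat (map F ps)) {x, y})"
proof -
  have block: "sorted_wrt (\<ge>) (filter (\<lambda>a. a = x \<or> a = y) xs)"
    if "\<not> (x \<in> set xs \<and> y \<in> set xs)" for xs
    using that by (induction xs) auto
  have "sorted_wrt (\<ge>) (filter (\<lambda>a. a = x \<or> a = y) (concat (map F ps)))"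
    using assms(2-)
  proof (induction ps)
    case (Cons p ps)
    have "sorted_wrt (\<ge>) (filter (\<lambda>a. a = x \<or> a = y) (concat (map F ps)))"
    proof (rule Cons.IH)
      show "sorted_wrt (<) ps"
        using Cons.prems(1) by simp
    qed (rule Cons.prems; simp)+
    moreover have "b \<le> a" if "a \<in> set (F p)" "p' \<in> set ps" "b \<in> set (F p')"
      "a = x \<or> a = y" "b = x \<or> b = y" for a b p'
    proof -
      have "p < p'"
        using Cons.prems(1) that(2) by simp
      then have "\<not> (a = x \<and> b = y)"
        using Cons.prems(3)[of p' p] that by auto
      then show ?thesis
        using that(4,5) \<open>x < y\<close> by auto
    qed
    moreover have "sorted_wrt (\<ge>) (filter (\<lambda>a. a = x \<or> a = y) (F p))"
      by (intro block Cons.prems(2)) simp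
    ultimately show ?case
      by (simp add: sorted_wrt_append) blast
  qed simp
  then show ?thesis
    by (simp add: has_12_match_iff_not_sorted_wrt_ge restrict_word_def)
qed

lemma antitone_labelling:
  fixes q :: "'a \<Rightarrow> real"
  assumes "finite V"
  shows "\<exists>f. bij_betw f V {1..card V} \<and> (\<forall>u\<in>V. \<forall>v\<in>V. q u < q v \<longrightarrow> f v < f u)"
  using assms
proof (induction V rule: finite_ranking_induct[where f = "\<lambda>v. - q v"])
  case empty
  then show ?case
    by (simp add: bij_betw_def)
next
  case (insert v V)
  from insert.IH obtain f where f: "bij_betw f V {1..card V}"
    and anti: "\<And>u v. u \<in> V \<Longrightarrow> v \<in> V \<Longrightarrow> q u < q v \<Longrightarrow> f v < f u"
    by blast
  show ?case
  proof (cases "v \<in> V")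
    case True
    with insert.IH show ?thesis
      by (simp add: insert_absorb)
  next
    case False
    \<comment> \<open>\<open>v\<close> has the least value of \<open>q\<close>, so it takes the new largest label.\<close>
    define g where "g = f(v := Suc (card V))"
    have "bij_betw g V {1..card V}"
      using f False by (subst bij_betw_cong[of _ _ f]) (auto simp: g_def)
    then have "bij_betw g (V \<union> {v}) ({1..card V} \<union> {g v})"
      using False by (subst notIn_Un_bij_betw3[symmetric]) (auto simp: g_def)
    moreover have "{1..card V} \<union> {g v} = {1..card (insert v V)}"
      using insert.hyps(1) False by (auto simp: g_def)
    ultimately have "bij_betw g (insert v V) {1..card (insert v V)}"
      by simp
    moreover have "f u < Suc (card V)" if "u \<in> V" for u
      using bij_betwE[OF f] that by (auto simp: less_Suc_eq_le)
    then have "\<forall>a\<in>insert v V. \<forall>b\<in>insert v V. q a < q b \<longrightarrow> g b < g a"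
      using anti insert.hyps(2) False by (force simp: g_def)
    ultimately show ?thesis
      by blast
  qed
qed

lemma disjoint_intervals_ordered:
  fixes A B :: "real set"
  assumes "is_interval A" "is_interval B" "A \<inter> B = {}"
    and "a \<in> A" "b \<in> B" "a < b" "p \<in> A" "p' \<in> B"
  shows "p < p'"
proof (rule ccontr)
  assume "\<not> p < p'"
  \<comment> \<open>Either \<open>a\<close> lies between \<open>p'\<close> and \<open>b\<close>, or \<open>p'\<close> lies between \<open>a\<close> and \<open>p\<close>.\<close>
  then have "a \<in> B \<or> p' \<in> A"
    using assms unfolding is_interval_1 by (metis less_le_not_le linorder_le_cases not_le)
  with assms show False
    by blast
qed

theorem theorem12:
  fixes V :: "'a set" and E :: "'a set set"
  assumes "simple_graph V E"
    and "co_interval_graph V E"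
  shows "representable_12 V E"
proof -
  from assms(2) obtain I :: "'a \<Rightarrow> real set"
    where int: "\<And>v. v \<in> V \<Longrightarrow> is_interval (I v)" and ne: "\<And>v. v \<in> V \<Longrightarrow> I v \<noteq> {}"
      and compl: "complement_edges V E = intersection_edges V I"
    unfolding co_interval_graph_def interval_graph_def by blast
  have fin: "finite V"
    using assms(1) by (simp add: simple_graph_def)
  have edge_iff: "{u, v} \<in> E \<longleftrightarrow> I u \<inter> I v = {}" if "u \<in> V" "v \<in> V" "u \<noteq> v" for u v
  proof -
    have "{u, v} \<in> E \<longleftrightarrow> {u, v} \<notin> complement_edges V E"
      using that by (auto simp: complement_edges_def)
    also have "\<dots> \<longleftrightarrow> I u \<inter> I v = {}"
      unfolding compl intersection_edges_def using that by (auto simp: doubleton_eq_iff)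
    finally show ?thesis .
  qed
  define common where "common u v = (SOME p. p \<in> I u \<inter> I v)" for u v
  have common: "common u v \<in> I u \<inter> I v" if "I u \<inter> I v \<noteq> {}" for u v
    unfolding common_def using that by (subst some_in_eq)
  \<comment> \<open>The point of \<open>I v\<close> by which \<open>v\<close> is ranked is itself one of the chosen points, so every
    label occurs in the word.\<close>
  define q where "q v = common v v" for v
  have q: "q v \<in> I v" if "v \<in> V" for v
    using common[of v v] ne[OF that] by (simp add: q_def)
  obtain f where f: "bij_betw f V {1..card V}"
    and anti: "\<And>u v. u \<in> V \<Longrightarrow> v \<in> V \<Longrightarrow> q u < q v \<Longrightarrow> f v < f u"
    using antitone_labelling[OF fin, of q] by blast
  have inj: "inj_on f V" and img: "f ` V = {1..card V}"
    using f by (auto simp: bij_betw_def)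
  define S where "S = (\<lambda>(u, v). common u v) ` (V \<times> V)"
  define ps where "ps = sorted_list_of_set S"
  have "finite S"
    using fin by (simp add: S_def)
  then have set_ps: "set ps = S" and sorted_ps: "sorted_wrt (<) ps"
    by (simp_all add: ps_def)
  define block where "block p = sorted_list_of_set (f ` {v \<in> V. p \<in> I v})" for p
  have set_block: "set (block p) = f ` {v \<in> V. p \<in> I v}" and sorted_block: "sorted (block p)" for p
    using fin by (simp_all add: block_def)
  have mem_block: "f v \<in> set (block p) \<longleftrightarrow> p \<in> I v" if "v \<in> V" for v p
    using inj that by (auto simp: set_block inj_on_eq_iff)
  define w where "w = concat (map block ps)"
  have set_w: "set w = {1..card V}"
  proof
    show "set w \<subseteq> {1..card V}"
      using img by (auto simp: w_def set_block)
    have "f v \<in> set w" if "v \<in> V" for v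
    proof -
      have "q v \<in> set ps"
        using that by (auto simp: set_ps S_def q_def)
      then show ?thesis
        using mem_block[OF that] q[OF that] by (auto simp: w_def)
    qed
    then show "{1..card V} \<subseteq> set w"
      unfolding img[symmetric] by blast
  qed
  have image_edge: "{f u, f v} \<in> (`) f ` E \<longleftrightarrow> {u, v} \<in> E" if "u \<in> V" "v \<in> V" for u v
  proof -
    have "E \<subseteq> Pow V"
      using assms(1) by (auto simp: simple_graph_def)
    then have "f ` {u, v} \<in> (`) f ` E \<longleftrightarrow> {u, v} \<in> E"
      using inj that by (intro inj_on_image_mem_iff[OF inj_on_image_Pow]) auto
    then show ?thesis
      by simp
  qed
  have rep: "{f u, f v} \<in> (`) f ` E \<longleftrightarrow> \<not> has_12_match (restrict_word w {f u, f v})"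
    if u: "u \<in> V" and v: "v \<in> V" and less: "f u < f v" for u v
  proof (cases "I u \<inter> I v = {}")
    case True
    \<comment> \<open>The larger label \<open>f v\<close> belongs to the interval on the left.\<close>
    have "q v < q u"
      using anti[OF u v] less q[OF u] q[OF v] True by (metis disjoint_iff less_asym linorder_neqE)
    have "\<not> has_12_match (restrict_word w {f u, f v})"
      unfolding w_def
    proof (rule no_12_match_if_larger_blocks_first[OF less sorted_ps])
      show "\<not> (f u \<in> set (block p) \<and> f v \<in> set (block p))" for p
        using True by (auto simp: mem_block u v)
      show "p < p'" if "f v \<in> set (block p)" "f u \<in> set (block p')" for p p'
        using that disjoint_intervals_ordered[OF int[OF v] int[OF u] _ q[OF v] q[OF u] \<open>q v < q u\<close>]
          True by (auto simp: mem_block u v)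
    qed
    moreover have "{u, v} \<in> E"
      using edge_iff[OF u v] True less by auto
    ultimately show ?thesis
      by (simp add: image_edge u v)
  next
    case False
    have "common u v \<in> set ps"
      using u v by (auto simp: set_ps S_def)
    then obtain as bs where "ps = as @ common u v # bs"
      by (meson split_list)
    then have w: "w = concat (map block as) @ block (common u v) @ concat (map block bs)"
      by (simp add: w_def)
    have "has_12_match (restrict_word w {f u, f v})"
      unfolding w using common[OF False] less sorted_block
      by (intro has_12_match_if_increasing_block) (auto simp: mem_block u v)
    moreover have "{u, v} \<notin> E"
      using edge_iff[OF u v] False less by auto
    ultimately show ?thesis
      by (simp add: image_edge u v)
  qed
  have "{x, y} \<in> (`) f ` E \<longleftrightarrow> \<not> has_12_match (restrict_word w {x, y})"
    if xy: "x \<in> {1..card V}" "y \<in> {1..card V}" and "x \<noteq> y" for x y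
  proof -
    obtain u v where "u \<in> V" "x = f u" "v \<in> V" "y = f v"
      using xy unfolding img[symmetric] by blast
    with rep[of u v] rep[of v u] \<open>x \<noteq> y\<close> show ?thesis
      by (cases "f u < f v") (auto simp: insert_commute)
  qed
  with set_w f show ?thesis
    unfolding representable_12_def labeled_12_representable_def by blast
qed

end
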